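(* Let $m\geq 2$ be an integer and let $\mathbf{q}=(q_1,\dots,q_m)\in[1,2]^m$ satisfy $$\frac{1}{q_1}+\cdots+\frac{1}{q_m}=\frac{m+1}{2}.$$ Then there is a finite constant $C$ such that $$\left(\sum_{j_1=1}^{n}\left(\sum_{j_2=1}^{n}\left(\cdots\left(\sum_{j_m=1}^{n}\left|T(e_{j_1},\dots,e_{j_m})\right|^{q_m}\right)^{\frac{q_{m-1}}{q_m}}\cdots\right)^{\frac{q_2}{q_3}}\right)^{\frac{q_1}{q_2}}\right)^{\frac{1}{q_1}}\leq C\,\|T\|$$ for all continuous $m$-linear forms $T:c_0\times\cdots\times c_0\to\mathbb{R}$ and all positive integers $n$, and the smallest such constant, denoted $C_{m,\mathbf{q}}^{\mathbb{R}}$, satisfies $$C_{m,\mathbf{q}}^{\mathbb{R}}\geq 2^{\frac{(m-1)\widehat{q}_{1,m}+\left(\sum_{i=2}^{m}\widehat{q}_{i,m}\right)-(m-1)q_1q_2\cdots q_m}{q_1q_2\cdots q_m}},$$ where $\widehat{q}_{i,m}:=\dfrac{q_1q_2\cdots q_m}{q_i}$ for $1\leq i\leq m$.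
   Context: Here $c_0$ is the real Banach space of real null sequences with the supremum norm, $(e_j)_{j\ge 1}$ is its sequence of canonical unit vectors, and $\|T\|=\sup\{|T(z_1,\dots,z_m)|:\|z_k\|\le 1,\ k=1,\dots,m\}$. *)

theory Defs
  imports "HOL-Analysis.Analysis"
begin

section \<open>The real Banach space of null sequences\<close>

text \<open>Sequences are indexed from 0, so the canonical unit vector usually written with index
  \<open>j \<ge> 1\<close> is \<open>e_c0 (j - 1)\<close>, and a sum over \<open>1 \<le> j \<le> n\<close> becomes a sum over \<open>{..<n}\<close>.\<close>

typedef c0 = "{x :: nat \<Rightarrow> real. x \<longlonglongrightarrow> 0}"
  morphisms c0_nth Abs_c0
  by (rule exI[of _ "\<lambda>_. 0"]) simp

setup_lifting type_definition_c0

lemma c0_nth_tendsto: "c0_nth x \<longlonglongrightarrow> 0"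
  using c0_nth[of x] by simp

lemma c0_eqI: "(\<And>i. c0_nth x i = c0_nth y i) \<Longrightarrow> x = y"
  by (simp add: c0_nth_inject[symmetric] fun_eq_iff)

instantiation c0 :: real_vector
begin

lift_definition zero_c0 :: c0 is "\<lambda>_. 0" by simp
lift_definition plus_c0 :: "c0 \<Rightarrow> c0 \<Rightarrow> c0" is "\<lambda>x y i. x i + y i"
  by (rule tendsto_add_zero)
lift_definition minus_c0 :: "c0 \<Rightarrow> c0 \<Rightarrow> c0" is "\<lambda>x y i. x i - y i"
  by (drule (1) tendsto_diff) simp
lift_definition uminus_c0 :: "c0 \<Rightarrow> c0" is "\<lambda>x i. - x i"
  by (drule tendsto_minus) simp
lift_definition scaleR_c0 :: "real \<Rightarrow> c0 \<Rightarrow> c0" is "\<lambda>r x i. r * x i"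
  by (rule tendsto_mult_right_zero)

instance
  by standard (transfer; simp add: fun_eq_iff algebra_simps)+

end

lemmas c0_nth_simps [simp] = zero_c0.rep_eq plus_c0.rep_eq minus_c0.rep_eq
  uminus_c0.rep_eq scaleR_c0.rep_eq

lemma c0_bdd_above: "bdd_above (range (\<lambda>i. \<bar>c0_nth x i\<bar>))"
proof -
  have "Bseq (c0_nth x)"
    using c0_nth_tendsto convergentI convergent_imp_Bseq by blast
  then show ?thesis
    by (auto simp: Bseq_def bdd_above_def)
qed

instantiation c0 :: real_normed_vector
begin

definition norm_c0 :: "c0 \<Rightarrow> real" where
  "norm_c0 x = (SUP i. \<bar>c0_nth x i\<bar>)"

definition dist_c0 :: "c0 \<Rightarrow> c0 \<Rightarrow> real" where
  "dist_c0 x y = norm (x - y)"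

definition sgn_c0 :: "c0 \<Rightarrow> c0" where
  "sgn_c0 x = x /\<^sub>R norm x"

definition uniformity_c0 :: "(c0 \<times> c0) filter" where
  "uniformity_c0 = (INF e\<in>{0 <..}. principal {(x, y). dist x y < e})"

definition open_c0 :: "c0 set \<Rightarrow> bool" where
  "open_c0 S = (\<forall>x\<in>S. \<forall>\<^sub>F (x', y) in uniformity. x' = x \<longrightarrow> y \<in> S)"

lemma abs_c0_nth_le_norm: "\<bar>c0_nth x i\<bar> \<le> norm x"
  unfolding norm_c0_def by (rule cSUP_upper[OF _ c0_bdd_above]) simp

lemma norm_c0_leI: "(\<And>i. \<bar>c0_nth x i\<bar> \<le> b) \<Longrightarrow> norm x \<le> b"
  unfolding norm_c0_def by (rule cSUP_least) auto

instance
proof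
  fix x y :: c0 and a :: real
  have nonneg: "0 \<le> norm z" for z :: c0
    using abs_c0_nth_le_norm[of z 0] by linarith
  have scale: "norm (b *\<^sub>R z) \<le> \<bar>b\<bar> * norm z" for b and z :: c0
    by (rule norm_c0_leI) (simp add: abs_mult mult_left_mono abs_c0_nth_le_norm)
  show "norm x = 0 \<longleftrightarrow> x = 0"
  proof
    assume *: "norm x = 0"
    show "x = 0"
    proof (rule c0_eqI)
      fix i show "c0_nth x i = c0_nth 0 i"
        using abs_c0_nth_le_norm[of x i] * by simp
    qed
  next
    assume "x = 0"
    then have "norm x \<le> 0" by (intro norm_c0_leI) simp
    then show "norm x = 0" using nonneg[of x] by simp
  qed
  show "norm (x + y) \<le> norm x + norm y"
  proof (rule norm_c0_leI)
    fix i show "\<bar>c0_nth (x + y) i\<bar> \<le> norm x + norm y"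
      using abs_c0_nth_le_norm[of x i] abs_c0_nth_le_norm[of y i] by simp
  qed
  show "norm (a *\<^sub>R x) = \<bar>a\<bar> * norm x"
  proof (cases "a = 0")
    case True
    then show ?thesis using scale[of 0 x] nonneg[of "0 *\<^sub>R x"] by simp
  next
    case False
    have "norm x \<le> \<bar>inverse a\<bar> * norm (a *\<^sub>R x)"
      using scale[of "inverse a" "a *\<^sub>R x"] False by simp
    then have "\<bar>a\<bar> * norm x \<le> norm (a *\<^sub>R x)"
      using False by (simp add: field_simps)
    with scale[of a x] show ?thesis by simp
  qed
qed (simp_all add: dist_c0_def sgn_c0_def uniformity_c0_def open_c0_def)

end

instance c0 :: banach
proof
  fix X :: "nat \<Rightarrow> c0"
  assume X: "Cauchy X"
  have unif: "\<exists>M. \<forall>m\<ge>M. \<forall>n\<ge>M. \<forall>i. \<bar>c0_nth (X m) i - c0_nth (X n) i\<bar> < e" if "e > 0" for e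
  proof -
    obtain M where "\<forall>m\<ge>M. \<forall>n\<ge>M. norm (X m - X n) < e"
      using CauchyD[OF X \<open>e > 0\<close>] by blast
    moreover have "\<bar>c0_nth (X m) i - c0_nth (X n) i\<bar> \<le> norm (X m - X n)" for m n i
      using abs_c0_nth_le_norm[of "X m - X n" i] by simp
    ultimately show ?thesis by (meson le_less_trans)
  qed
  have "\<exists>l. (\<lambda>n. c0_nth (X n) i) \<longlonglongrightarrow> l" for i
  proof -
    have "Cauchy (\<lambda>n. c0_nth (X n) i)"
      unfolding Cauchy_def dist_real_def using unif by blast
    then show ?thesis using Cauchy_convergent convergent_def by blast
  qed
  then obtain g where g: "\<And>i. (\<lambda>n. c0_nth (X n) i) \<longlonglongrightarrow> g i" by metis
  have close: "\<exists>M. \<forall>m\<ge>M. \<forall>i. \<bar>c0_nth (X m) i - g i\<bar> \<le> e" if "e > 0" for e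
  proof -
    obtain M where M: "\<forall>m\<ge>M. \<forall>n\<ge>M. \<forall>i. \<bar>c0_nth (X m) i - c0_nth (X n) i\<bar> < e"
      using unif[OF \<open>e > 0\<close>] by blast
    have "\<bar>c0_nth (X m) i - g i\<bar> \<le> e" if "m \<ge> M" for m i
    proof (rule LIMSEQ_le_const2)
      show "(\<lambda>n. \<bar>c0_nth (X m) i - c0_nth (X n) i\<bar>) \<longlonglongrightarrow> \<bar>c0_nth (X m) i - g i\<bar>"
        by (intro tendsto_intros g)
      show "\<exists>N. \<forall>n\<ge>N. \<bar>c0_nth (X m) i - c0_nth (X n) i\<bar> \<le> e"
        using M that less_imp_le by blast
    qed
    then show ?thesis by blast
  qed
  have "g \<longlonglongrightarrow> 0"
  proof (rule LIMSEQ_I)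
    fix r :: real assume "0 < r"
    then obtain M where M: "\<And>i. \<bar>c0_nth (X M) i - g i\<bar> \<le> r / 2"
      using close[of "r / 2"] by auto
    obtain N where N: "\<forall>i\<ge>N. norm (c0_nth (X M) i - 0) < r / 2"
      using LIMSEQ_D[OF c0_nth_tendsto[of "X M"], of "r / 2"] \<open>0 < r\<close> by auto
    show "\<exists>no. \<forall>n\<ge>no. norm (g n - 0) < r"
    proof (intro exI allI impI)
      fix i assume "i \<ge> N"
      then have "\<bar>c0_nth (X M) i\<bar> < r / 2" using N by simp
      with M[of i] show "norm (g i - 0) < r"
        unfolding real_norm_def abs_less_iff abs_le_iff by linarith
    qed
  qed
  then have nth_g: "c0_nth (Abs_c0 g) = g" by (simp add: Abs_c0_inverse)
  have "X \<longlonglongrightarrow> Abs_c0 g"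
  proof (rule LIMSEQ_I)
    fix r :: real assume "0 < r"
    then obtain M where M: "\<forall>m\<ge>M. \<forall>i. \<bar>c0_nth (X m) i - g i\<bar> \<le> r / 2"
      using close[of "r / 2"] by auto
    have "norm (X m - Abs_c0 g) \<le> r / 2" if "m \<ge> M" for m
      by (rule norm_c0_leI) (use M that nth_g in simp)
    then show "\<exists>no. \<forall>n\<ge>no. norm (X n - Abs_c0 g) < r"
      using \<open>0 < r\<close> by (intro exI[of _ M] allI impI) (smt (verit) field_sum_of_halves)
  qed
  then show "convergent X" by (rule convergentI)
qed

lift_definition e_c0 :: "nat \<Rightarrow> c0" is "\<lambda>j i. if i = j then 1 else 0"
proof -
  fix j :: nat
  have "eventually (\<lambda>i. (if i = j then 1 else 0 :: real) = 0) sequentially"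
    using eventually_gt_at_top[of j] by eventually_elim simp
  then show "(\<lambda>i. if i = j then 1 else 0 :: real) \<longlonglongrightarrow> 0"
    by (rule tendsto_eventually)
qed


section \<open>Multilinear forms\<close>

text \<open>The \<open>m\<close>-fold product of \<open>'a\<close> is the set \<open>{1..m} \<rightarrow>\<^sub>E UNIV\<close> of extensional functions, which is
  also the carrier of the product topology; values of a form outside it are irrelevant.\<close>

definition multilinear_form :: "nat \<Rightarrow> ((nat \<Rightarrow> 'a::real_vector) \<Rightarrow> real) \<Rightarrow> bool" where
  "multilinear_form m T \<longleftrightarrow>
     (\<forall>z \<in> {1..m} \<rightarrow>\<^sub>E UNIV. \<forall>k \<in> {1..m}. linear (\<lambda>x. T (z(k := x))))"

definition continuous_multilinear_form ::
    "nat \<Rightarrow> ((nat \<Rightarrow> 'a::real_normed_vector) \<Rightarrow> real) \<Rightarrow> bool" where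
  "continuous_multilinear_form m T \<longleftrightarrow> multilinear_form m T \<and>
     continuous_map (product_topology (\<lambda>_. euclidean) {1..m}) euclideanreal T"

definition form_norm :: "nat \<Rightarrow> ((nat \<Rightarrow> 'a::real_normed_vector) \<Rightarrow> real) \<Rightarrow> real" where
  "form_norm m T = (SUP z \<in> {1..m} \<rightarrow>\<^sub>E {x. norm x \<le> 1}. \<bar>T z\<bar>)"


section \<open>Mixed sums and the optimal constant\<close>

text \<open>\<open>nested_sum n q a k d j\<close> is the part of the iterated sum that runs over the indices in
  positions \<open>k, ..., k + d\<close>, the earlier indices being fixed by \<open>j\<close>. With \<open>d = m - k\<close> it is the sum
  over position \<open>k\<close> of \<open>(\<dots>) powr (q k / q (k + 1))\<close>, where the innermost summand is
  \<open>\<bar>a j\<bar> powr q m\<close>.\<close>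

primrec nested_sum ::
    "nat \<Rightarrow> (nat \<Rightarrow> real) \<Rightarrow> ((nat \<Rightarrow> nat) \<Rightarrow> real) \<Rightarrow> nat \<Rightarrow> nat \<Rightarrow> (nat \<Rightarrow> nat) \<Rightarrow> real" where
  "nested_sum n q a k 0 j = (\<Sum>i<n. \<bar>a (j(k := i))\<bar> powr q k)"
| "nested_sum n q a k (Suc d) j =
     (\<Sum>i<n. nested_sum n q a (Suc k) d (j(k := i)) powr (q k / q (Suc k)))"

text \<open>Every position in \<open>{1..m}\<close> is overwritten before \<open>a\<close> is applied, so the initial index
  function \<open>\<lambda>_. 0\<close> plays no role.\<close>

definition mixed_sum ::
    "nat \<Rightarrow> (nat \<Rightarrow> real) \<Rightarrow> nat \<Rightarrow> ((nat \<Rightarrow> nat) \<Rightarrow> real) \<Rightarrow> real" where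
  "mixed_sum m q n a = nested_sum n q a 1 (m - 1) (\<lambda>_. 0) powr (1 / q 1)"

definition BH_inequality :: "nat \<Rightarrow> (nat \<Rightarrow> real) \<Rightarrow> real \<Rightarrow> bool" where
  "BH_inequality m q C \<longleftrightarrow>
     (\<forall>T :: (nat \<Rightarrow> c0) \<Rightarrow> real. continuous_multilinear_form m T \<longrightarrow>
       (\<forall>n\<ge>1. mixed_sum m q n (\<lambda>j. T (\<lambda>k\<in>{1..m}. e_c0 (j k))) \<le> C * form_norm m T))"

definition BH_const :: "nat \<Rightarrow> (nat \<Rightarrow> real) \<Rightarrow> real" where
  "BH_const m q = (LEAST C. BH_inequality m q C)"

definition q_hat :: "nat \<Rightarrow> (nat \<Rightarrow> real) \<Rightarrow> nat \<Rightarrow> real" where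
  "q_hat m q i = (\<Prod>k=1..m. q k) / q i"

end

theory Submission
  imports Defs
begin

text \<open>
The upper estimate interpolates between extreme exponents. If one exponent is \<open>1\<close> and the others are
\<open>2\<close>, the inequality follows from three classical facts. The Minkowski inequality makes the
position with exponent \<open>1\<close> the outermost one (\<open>mixed_norm_Minkowski\<close>). The Khinchin inequality for
vectors in \<open>\<ell>\<^sub>2\<close> replaces the square sum over each of the other \<open>m - 1\<close> positions by an average over
random signs (\<open>multiple_Khinchin\<close>). For fixed signs, the remaining sum of absolute values is the value of
\<open>T\<close> at a point of the unit ball, since \<open>\<Sum>i<n. \<plusminus>e_i\<close> has norm at most \<open>1\<close> in \<open>c0\<close>
(\<open>mixed_norm_one_two_le\<close>). The condition \<open>\<Sum>i. 1 / q i = (m + 1) / 2\<close> with \<open>q i \<in> {1..2}\<close> says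
precisely that \<open>(1 / q i)\<close> is a convex combination of the reciprocals of the \<open>m\<close> extreme exponents, and the
Hoelder inequality for mixed norms (\<open>mixed_norm_interpolation\<close>) gives the general case, with constant
\<open>2 ^ (m - 1)\<close>.

The lower estimate comes from a form built on a binary tree with \<open>2 ^ (m - 1)\<close> leaves (\<open>tree_form\<close>). Its
norm is at most \<open>2 ^ (m - 1)\<close>. Its coefficients are \<open>0\<close> or \<open>\<plusminus>1\<close>, and the
nonzero ones are arranged so that there are \<open>2 ^ (m - 1)\<close> choices for the first index, and then two choices for each of the later
ones. Its mixed sum is therefore \<open>2\<close> to the power \<open>(m - 1) / q 1 + \<Sum>i=2..m. 1 / q i\<close>, whatever the
exponents are. Dividing by the norm gives the exponent
\<open>(m - 1) / q 1 + (\<Sum>i=2..m. 1 / q i) - (m - 1)\<close>, which the theorem states over the common denominator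
\<open>\<Prod>i=1..m. q i\<close>.
\<close>

section \<open>Positive linear functionals\<close>

text \<open>Khinchin's inequality is needed for vectors in the \<open>\<ell>\<^sub>2\<close> space over a multi-index set, and two kinds of
linear functional occur in it: the sum over multi-indices, which defines that space, and the average
over signs. Both are treated through positivity and linearity only, so no Hilbert space has to be
constructed: \<open>L (\<lambda>x. f x * g x)\<close> is the inner product.\<close>

definition pos_lin :: "(('x \<Rightarrow> real) \<Rightarrow> real) \<Rightarrow> bool" where
  "pos_lin L \<longleftrightarrow> (\<forall>f g. L (\<lambda>x. f x + g x) = L f + L g) \<and> (\<forall>c f. L (\<lambda>x. c * f x) = c * L f) \<and>
     (\<forall>f. (\<forall>x. 0 \<le> f x) \<longrightarrow> 0 \<le> L f)"

lemma pos_linD: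
  assumes "pos_lin L"
  shows pos_lin_add: "L (\<lambda>x. f x + g x) = L f + L g"
    and pos_lin_scale: "L (\<lambda>x. c * f x) = c * L f"
    and pos_lin_nonneg: "(\<And>x. 0 \<le> f x) \<Longrightarrow> 0 \<le> L f"
  using assms unfolding pos_lin_def by blast+

lemma pos_lin_diff:
  assumes "pos_lin L"
  shows "L (\<lambda>x. f x - g x) = L f - L g"
  using pos_lin_add[OF assms, of f "\<lambda>x. (-1) * g x"] pos_lin_scale[OF assms, of "-1" g] by simp

lemma pos_lin_sum:
  assumes "pos_lin L"
  shows "L (\<lambda>x. \<Sum>i\<in>I. f i x) = (\<Sum>i\<in>I. L (f i))"
proof (induction I rule: infinite_finite_induct)
  case (insert i I)
  then show ?case by (simp add: pos_lin_add[OF assms])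
qed (use pos_lin_scale[OF assms, of 0 "\<lambda>_. 0"] in simp_all)

lemma pos_lin_mono:
  assumes "pos_lin L" "\<And>x. f x \<le> g x"
  shows "L f \<le> L g"
  using pos_lin_nonneg[OF assms(1), of "\<lambda>x. g x - f x"] assms(2) by (simp add: pos_lin_diff[OF assms(1)])

lemma pos_lin_square_expand:
  assumes "pos_lin L"
  shows "L (\<lambda>x. (f x + c * g x)\<^sup>2) = L (\<lambda>x. (f x)\<^sup>2) + c * (2 * L (\<lambda>x. f x * g x)) + c\<^sup>2 * L (\<lambda>x. (g x)\<^sup>2)"
proof -
  have "L (\<lambda>x. (f x + c * g x)\<^sup>2) = L (\<lambda>x. (f x)\<^sup>2 + (c * (2 * (f x * g x)) + c\<^sup>2 * (g x)\<^sup>2))"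
    by (rule arg_cong[of _ _ L]) (simp add: fun_eq_iff power2_eq_square algebra_simps)
  then show ?thesis
    by (simp only: pos_linD[OF assms])
qed

text \<open>The quadratic polynomial \<open>c \<mapsto> L ((f + c g)\<^sup>2)\<close> is nonnegative, so its discriminant is not
positive.\<close>

lemma pos_lin_Cauchy_Schwarz:
  assumes "pos_lin L"
  shows "(L (\<lambda>x. f x * g x))\<^sup>2 \<le> L (\<lambda>x. (f x)\<^sup>2) * L (\<lambda>x. (g x)\<^sup>2)"
proof -
  define F G B where "F = L (\<lambda>x. (f x)\<^sup>2)" and "G = L (\<lambda>x. (g x)\<^sup>2)" and "B = L (\<lambda>x. f x * g x)"
  have q: "0 \<le> F + c * (2 * B) + c\<^sup>2 * G" for c
    unfolding F_def G_def B_def pos_lin_square_expand[OF assms, symmetric]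
    by (rule pos_lin_nonneg[OF assms]) simp
  have "F \<ge> 0" "G \<ge> 0"
    unfolding F_def G_def by (rule pos_lin_nonneg[OF assms], simp)+
  have "B\<^sup>2 \<le> F * G"
  proof (cases "G = 0")
    case True
    have "B = 0"
    proof (rule ccontr)
      assume "B \<noteq> 0"
      \<comment> \<open>The polynomial has degree one, and this value of \<open>c\<close> makes it equal to \<open>-1\<close>.\<close>
      with q[of "- (F + 1) / (2 * B)"] True show False by (simp add: field_simps)
    qed
    with True show ?thesis by simp
  next
    case False
    with \<open>G \<ge> 0\<close> have "G > 0" by simp
    \<comment> \<open>The value of \<open>c\<close> that minimises the polynomial.\<close>
    with q[of "- B / G"] show ?thesis by (simp add: field_simps power2_eq_square)
  qed
  then show ?thesis by (simp add: F_def G_def B_def)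
qed

section \<open>Averages over signs and the Khinchin inequality\<close>

text \<open>The expectation of \<open>F e\<close> over independent uniform signs \<open>e 0, \<dots>, e (n - 1)\<close>. The coordinates
from \<open>n\<close> on are set to the value \<open>1\<close>, so that every \<open>e\<close> that occurs is a sign sequence on all of
\<open>nat\<close>. One sign is averaged out at a time, which makes the moment computations inductions on
\<open>n\<close>.\<close>

primrec sign_avg :: "nat \<Rightarrow> ((nat \<Rightarrow> real) \<Rightarrow> real) \<Rightarrow> real" where
  "sign_avg 0 F = F (\<lambda>_. 1)"
| "sign_avg (Suc n) F = sign_avg n (\<lambda>e. (F (e(n := 1)) + F (e(n := -1))) / 2)"

lemma pos_lin_sign_avg: "pos_lin (sign_avg n)"
proof (induction n)
  case 0
  then show ?case by (simp add: pos_lin_def)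
next
  case (Suc n)
  show ?case
    unfolding pos_lin_def
  proof (intro conjI allI impI)
    fix f g :: "(nat \<Rightarrow> real) \<Rightarrow> real" and c :: real
    show "sign_avg (Suc n) (\<lambda>x. f x + g x) = sign_avg (Suc n) f + sign_avg (Suc n) g"
      by (simp add: pos_lin_add[OF Suc, symmetric] add_divide_distrib algebra_simps)
    show "sign_avg (Suc n) (\<lambda>x. c * f x) = c * sign_avg (Suc n) f"
      by (simp add: pos_lin_scale[OF Suc, symmetric] add_divide_distrib algebra_simps)
    assume "\<forall>x. 0 \<le> f x"
    then show "0 \<le> sign_avg (Suc n) f"
      by (auto intro!: pos_lin_nonneg[OF Suc])
  qed
qed

lemma sign_avg_const: "sign_avg n (\<lambda>_. c) = c"
  by (induction n) simp_all

lemma sign_avg_le: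
  assumes "\<And>e. (\<And>i. e i \<in> {-1, 1}) \<Longrightarrow> F e \<le> M"
  shows "sign_avg n F \<le> M"
  using assms
proof (induction n arbitrary: F)
  case 0
  then show ?case by simp
next
  case (Suc n)
  have "(F (e(n := 1)) + F (e(n := -1))) / 2 \<le> M" if "\<And>i. e i \<in> {-1, 1}" for e
  proof -
    have "F (e(n := 1)) \<le> M" "F (e(n := -1)) \<le> M"
      using that by (intro Suc.prems; simp)+
    then show ?thesis by simp
  qed
  then show ?case using Suc.IH by simp
qed

lemma sign_sum_step:
  "(\<Sum>i<Suc n. (e(n := c)) i * a i x) = (\<Sum>i<n. e i * a i x) + c * (a n x :: real)"
  by simp

text \<open>In the step the mixed terms for the signs \<open>1\<close> and \<open>-1\<close> cancel.\<close>

lemma sign_avg_second_moment: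
  assumes L: "pos_lin L"
  shows "sign_avg n (\<lambda>e. L (\<lambda>x. (\<Sum>i<n. e i * a i x)\<^sup>2)) = (\<Sum>i<n. L (\<lambda>x. (a i x)\<^sup>2))"
proof (induction n)
  case 0
  then show ?case using pos_lin_scale[OF L, of 0 "\<lambda>_. 0"] by simp
next
  case (Suc n)
  show ?case
    unfolding sign_avg.simps sign_sum_step pos_lin_square_expand[OF L]
    by (simp add: add_divide_distrib pos_lin_add[OF pos_lin_sign_avg] Suc sign_avg_const)
qed

text \<open>Let \<open>Q\<close> be the squared length of the random vector, and \<open>t\<close> that of a new vector added to it
with a random sign. Averaging over this sign turns \<open>Q\<^sup>2\<close> into \<open>(Q + t)\<^sup>2 + 4 B\<^sup>2\<close>, where \<open>B\<close> is the inner
product of the two vectors, and \<open>B\<^sup>2 \<le> Q t\<close>. So the fourth moment grows by at most \<open>6 t E Q + t\<^sup>2\<close>,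
while \<open>3 s\<^sup>2\<close> grows by \<open>6 s t + 3 t\<^sup>2\<close>.\<close>

lemma sign_avg_fourth_moment:
  assumes L: "pos_lin L"
  shows "sign_avg n (\<lambda>e. (L (\<lambda>x. (\<Sum>i<n. e i * a i x)\<^sup>2))\<^sup>2) \<le> 3 * (\<Sum>i<n. L (\<lambda>x. (a i x)\<^sup>2))\<^sup>2"
proof (induction n)
  case 0
  then show ?case using pos_lin_scale[OF L, of 0 "\<lambda>_. 0"] by simp
next
  case (Suc n)
  define X where "X e x = (\<Sum>i<n. e i * a i x)" for e x
  define Q where "Q e = L (\<lambda>x. (X e x)\<^sup>2)" for e
  define t where "t = L (\<lambda>x. (a n x)\<^sup>2)"
  define s where "s = (\<Sum>i<n. L (\<lambda>x. (a i x)\<^sup>2))"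
  have t: "t \<ge> 0" and s: "s \<ge> 0"
    unfolding t_def s_def by (auto intro!: pos_lin_nonneg[OF L] sum_nonneg)
  note lin = pos_linD[OF pos_lin_sign_avg]
  have step: "((Q e + c * (2 * B) + c\<^sup>2 * t)\<^sup>2 + (Q e + d * (2 * B) + d\<^sup>2 * t)\<^sup>2) / 2
      \<le> (Q e)\<^sup>2 + ((6 * t) * Q e + t\<^sup>2)"
    if "B = L (\<lambda>x. X e x * a n x)" "c = 1" "d = -1" for e B c d
  proof -
    have "B\<^sup>2 \<le> Q e * t"
      unfolding that Q_def t_def by (rule pos_lin_Cauchy_Schwarz[OF L])
    then show ?thesis unfolding that(2,3) by (simp add: power2_eq_square algebra_simps)
  qed
  have "sign_avg (Suc n) (\<lambda>e. (L (\<lambda>x. (\<Sum>i<Suc n. e i * a i x)\<^sup>2))\<^sup>2)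
      \<le> sign_avg n (\<lambda>e. (Q e)\<^sup>2 + ((6 * t) * Q e + t\<^sup>2))"
    unfolding sign_avg.simps sign_sum_step pos_lin_square_expand[OF L]
      X_def[symmetric] Q_def[symmetric] t_def[symmetric]
    by (rule pos_lin_mono[OF pos_lin_sign_avg]) (rule step, simp_all)
  also have "\<dots> = sign_avg n (\<lambda>e. (Q e)\<^sup>2) + ((6 * t) * s + t\<^sup>2)"
    using sign_avg_second_moment[OF L, of n a]
    by (simp only: lin(1) lin(2) sign_avg_const) (simp add: Q_def X_def s_def)
  also have "\<dots> \<le> 3 * s\<^sup>2 + ((6 * t) * s + t\<^sup>2)"
    using Suc by (simp add: Q_def X_def s_def)
  also have "\<dots> \<le> 3 * (s + t)\<^sup>2"
    using s t by (simp add: power2_eq_square algebra_simps)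
  finally show ?case by (simp add: s_def t_def)
qed

text \<open>The random vector has length \<open>Y = sqrt Q\<close> with \<open>E Y\<^sup>2 = s\<close> and \<open>E Y\<^sup>4 \<le> 3 s\<^sup>2\<close>. A variable whose
fourth moment is comparable with the square of its second moment cannot have a small first
moment: with \<open>\<sigma> = sqrt s\<close>, averaging the pointwise bound
\<open>3 y\<^sup>2 / (4 \<sigma>) - y\<^sup>4 / (16 \<sigma>\<^sup>3) \<le> y\<close> gives \<open>E Y \<ge> (9 / 16) \<sigma>\<close>,
and \<open>16 / 9 \<le> 2\<close>.\<close>

lemma Khinchin_L1:
  assumes L: "pos_lin L"
  shows "sqrt (\<Sum>i<n. L (\<lambda>x. (a i x)\<^sup>2)) \<le> 2 * sign_avg n (\<lambda>e. sqrt (L (\<lambda>x. (\<Sum>i<n. e i * a i x)\<^sup>2)))"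
proof -
  define Q where "Q e = L (\<lambda>x. (\<Sum>i<n. e i * a i x)\<^sup>2)" for e
  define s where "s = (\<Sum>i<n. L (\<lambda>x. (a i x)\<^sup>2))"
  define \<sigma> where "\<sigma> = sqrt s"
  have Q: "Q e \<ge> 0" for e
    unfolding Q_def by (auto intro!: pos_lin_nonneg[OF L])
  have s: "s \<ge> 0"
    unfolding s_def by (auto intro!: pos_lin_nonneg[OF L] sum_nonneg)
  have avg0: "0 \<le> sign_avg n (\<lambda>e. sqrt (Q e))"
    using Q by (intro pos_lin_nonneg[OF pos_lin_sign_avg]) simp
  have "\<sigma> \<le> 2 * sign_avg n (\<lambda>e. sqrt (Q e))"
  proof (cases "s = 0")
    case True
    with avg0 show ?thesis by (simp add: \<sigma>_def)
  next
    case False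
    with s have \<sigma>: "\<sigma> > 0" and ss: "s = \<sigma>\<^sup>2" by (simp_all add: \<sigma>_def)
    have point: "3 / (4 * \<sigma>) * Q e - 1 / (16 * \<sigma>^3) * (Q e)\<^sup>2 \<le> sqrt (Q e)" for e
    proof -
      define y where "y = sqrt (Q e)"
      have y: "y \<ge> 0" and Qy: "Q e = y\<^sup>2" using Q by (simp_all add: y_def)
      \<comment> \<open>Up to the factor \<open>16 \<sigma>\<^sup>3\<close> this product is the difference of the two sides of the pointwise bound.\<close>
      have "0 \<le> y * ((y - 2 * \<sigma>)\<^sup>2 * (y + 4 * \<sigma>))"
        using y \<sigma> by simp
      then show ?thesis
        unfolding y_def[symmetric] Qy using \<sigma> y
        by (simp add: field_simps power2_eq_square power3_eq_cube)
    qed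
    have "sign_avg n Q = s" "sign_avg n (\<lambda>e. (Q e)\<^sup>2) \<le> 3 * s\<^sup>2"
      using sign_avg_second_moment[OF L, of n a] sign_avg_fourth_moment[OF L, of n a]
      by (simp_all add: Q_def[abs_def] s_def)
    then have "3 / (4 * \<sigma>) * s - 1 / (16 * \<sigma>^3) * (3 * s\<^sup>2)
        \<le> 3 / (4 * \<sigma>) * sign_avg n Q - 1 / (16 * \<sigma>^3) * sign_avg n (\<lambda>e. (Q e)\<^sup>2)"
      using \<sigma> by (intro diff_mono mult_left_mono) auto
    also have "\<dots> = sign_avg n (\<lambda>e. 3 / (4 * \<sigma>) * Q e - 1 / (16 * \<sigma>^3) * (Q e)\<^sup>2)"
      by (simp only: pos_lin_diff[OF pos_lin_sign_avg] pos_lin_scale[OF pos_lin_sign_avg])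
    also have "\<dots> \<le> sign_avg n (\<lambda>e. sqrt (Q e))"
      by (rule pos_lin_mono[OF pos_lin_sign_avg point])
    finally show ?thesis
      using \<sigma> unfolding ss by (simp add: field_simps power2_eq_square power3_eq_cube)
  qed
  then show ?thesis by (simp add: \<sigma>_def s_def Q_def)
qed

section \<open>Iterated sums over multi-indices\<close>

text \<open>Multi-indices are functions \<open>j\<close>, and the list names the positions that are summed over; the others
keep their value in \<open>j\<close>. With general weights \<open>w\<close> this is the value of the multilinear form with
coefficients \<open>f\<close> at the vectors \<open>w x\<close>; with weights \<open>1\<close> (\<open>isum\<close> below) it is the plain sum.\<close>

primrec wsum :: "nat \<Rightarrow> (nat \<Rightarrow> nat \<Rightarrow> real) \<Rightarrow> nat list \<Rightarrow> ((nat \<Rightarrow> nat) \<Rightarrow> real) \<Rightarrow> (nat \<Rightarrow> nat) \<Rightarrow> real" where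
  "wsum n w [] f j = f j"
| "wsum n w (x # xs) f j = (\<Sum>i<n. w x i * wsum n w xs f (j(x := i)))"

lemma wsum_add: "wsum n w xs (\<lambda>j. f j + g j) j = wsum n w xs f j + wsum n w xs g j"
  by (induction xs arbitrary: j) (simp_all add: sum.distrib algebra_simps)

lemma wsum_scale: "wsum n w xs (\<lambda>j. c * f j) j = c * wsum n w xs f j"
  by (induction xs arbitrary: j) (simp_all add: sum_distrib_left algebra_simps)

lemma wsum_sum: "wsum n w xs (\<lambda>j. \<Sum>i\<in>I. f i j) j = (\<Sum>i\<in>I. wsum n w xs (f i) j)"
proof (induction I rule: infinite_finite_induct)
  case (insert i I)
  then show ?case by (simp add: wsum_add)
qed (use wsum_scale[where c = 0 and f = "\<lambda>_. 0"] in simp_all)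

lemma wsum_nonneg:
  assumes "\<And>x i. w x i \<ge> 0" "\<And>j. f j \<ge> 0"
  shows "wsum n w xs f j \<ge> 0"
  by (induction xs arbitrary: j) (simp_all add: assms sum_nonneg)

lemma pos_lin_wsum: "(\<And>x i. w x i \<ge> 0) \<Longrightarrow> pos_lin (\<lambda>f. wsum n w xs f j)"
  by (simp add: pos_lin_def wsum_add wsum_scale wsum_nonneg)

lemma wsum_upd:
  assumes "x \<notin> set xs"
  shows "wsum n w xs f (j(x := i)) = wsum n w xs (\<lambda>j. f (j(x := i))) j"
  using assms by (induction xs arbitrary: j) (simp_all add: fun_upd_twist)

lemma wsum_weight_cong:
  assumes "\<And>x. x \<in> set xs \<Longrightarrow> w x = w' x"
  shows "wsum n w xs f j = wsum n w' xs f j"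
  using assms by (induction xs arbitrary: j) simp_all

abbreviation isum where "isum n \<equiv> wsum n (\<lambda>_ _. 1)"

text \<open>Positions are removed one at a time. One application of the Khinchin inequality to position \<open>x\<close>, with
vectors in the \<open>\<ell>\<^sub>2\<close> space over the remaining positions, replaces the sum over that position by random
signs \<open>e\<close>, at the cost of a factor \<open>2\<close>; for fixed \<open>e\<close> the family \<open>b e\<close> of signed sums satisfies the
hypothesis again. The outer sum over \<open>S\<close> stays outside throughout, because the final bound holds for
the sum over \<open>l\<close> and not for its terms.\<close>

lemma multiple_Khinchin:
  assumes "distinct xs"
    and "\<And>w. (\<And>x i. w x i \<in> {-1, 1}) \<Longrightarrow> (\<Sum>l\<in>S. \<bar>wsum n w xs (a l) j\<bar>) \<le> M"
  shows "(\<Sum>l\<in>S. sqrt (isum n xs (\<lambda>j. (a l j)\<^sup>2) j)) \<le> 2 ^ length xs * M"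
  using assms
proof (induction xs arbitrary: a)
  case Nil
  from Nil.prems(2)[of "\<lambda>_ _. 1"] show ?case by simp
next
  case (Cons x xs)
  define b where "b e l j = (\<Sum>i<n. e i * a l (j(x := i)))" for e :: "nat \<Rightarrow> real" and l j
  have x: "x \<notin> set xs" using Cons.prems by simp
  have IH: "(\<Sum>l\<in>S. sqrt (isum n xs (\<lambda>j. (b e l j)\<^sup>2) j)) \<le> 2 ^ length xs * M"
    if e: "\<And>i. e i \<in> {-1, 1}" for e
  proof (rule Cons.IH)
    fix w :: "nat \<Rightarrow> nat \<Rightarrow> real" assume w: "\<And>x i. w x i \<in> {-1, 1}"
    have "wsum n w xs (b e l) j = wsum n (w(x := e)) (x # xs) (a l) j" for l
    proof -
      have "wsum n w xs (b e l) j = (\<Sum>i<n. e i * wsum n w xs (a l) (j(x := i)))"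
        unfolding b_def by (simp add: wsum_sum wsum_scale wsum_upd[OF x])
      also have "\<dots> = wsum n (w(x := e)) (x # xs) (a l) j"
        using x by (auto intro!: sum.cong wsum_weight_cong)
      finally show ?thesis .
    qed
    moreover have "(w(x := e)) y i \<in> {-1, 1}" for y i
      using w e by auto
    ultimately show "(\<Sum>l\<in>S. \<bar>wsum n w xs (b e l) j\<bar>) \<le> M"
      using Cons.prems(2)[of "w(x := e)"] by presburger
  qed (use Cons.prems in simp)
  have "(\<Sum>l\<in>S. sqrt (isum n (x # xs) (\<lambda>j. (a l j)\<^sup>2) j))
      = (\<Sum>l\<in>S. sqrt (\<Sum>i<n. isum n xs (\<lambda>j. (a l (j(x := i)))\<^sup>2) j))"
    by (simp add: wsum_upd[OF x])
  also have "\<dots> \<le> (\<Sum>l\<in>S. 2 * sign_avg n (\<lambda>e. sqrt (isum n xs (\<lambda>j. (b e l j)\<^sup>2) j)))"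
    unfolding b_def by (intro sum_mono Khinchin_L1[of "\<lambda>f. isum n xs f j"] pos_lin_wsum) simp
  also have "\<dots> = 2 * sign_avg n (\<lambda>e. \<Sum>l\<in>S. sqrt (isum n xs (\<lambda>j. (b e l j)\<^sup>2) j))"
    by (simp add: pos_lin_sum[OF pos_lin_sign_avg] sum_distrib_left)
  also have "\<dots> \<le> 2 * (2 ^ length xs * M)"
    using IH by (intro mult_left_mono sign_avg_le) auto
  finally show ?case by simp
qed

section \<open>Mixed norms: Minkowski and Hoelder\<close>

text \<open>The iterated norm with exponent \<open>q x\<close> in position \<open>x\<close>, the head of the list being the outermost
position. Taking the root at every level, instead of once at the end, makes each level a norm of the
level below; the order of the positions can then be changed.\<close>

primrec mixed_norm ::
  "nat \<Rightarrow> (nat \<Rightarrow> real) \<Rightarrow> nat list \<Rightarrow> ((nat \<Rightarrow> nat) \<Rightarrow> real) \<Rightarrow> (nat \<Rightarrow> nat) \<Rightarrow> real" where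
  "mixed_norm n q [] a j = \<bar>a j\<bar>"
| "mixed_norm n q (x # xs) a j = (\<Sum>i<n. mixed_norm n q xs a (j(x := i)) powr q x) powr (1 / q x)"

lemma mixed_norm_nonneg: "mixed_norm n q xs a j \<ge> 0"
  by (cases xs) simp_all

lemma nested_sum_eq_mixed_norm:
  "nested_sum n q a k d j powr (1 / q k) = mixed_norm n q [k..<Suc (k + d)] a j"
proof (induction d arbitrary: k j)
  case 0
  then show ?case by simp
next
  case (Suc d)
  have "[k..<Suc (k + Suc d)] = k # [Suc k..<Suc (Suc k + d)]"
    by (subst upt_conv_Cons) (simp_all del: upt_Suc)
  then show ?case
    by (simp only: nested_sum.simps mixed_norm.simps Suc[symmetric] powr_powr) simp
qed

lemma mixed_sum_eq_mixed_norm: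
  assumes "m \<ge> 1"
  shows "mixed_sum m q n a = mixed_norm n q [1..<Suc m] a (\<lambda>_. 0)"
  using nested_sum_eq_mixed_norm[of n q a 1 "m - 1" "\<lambda>_. 0"] assms by (simp add: mixed_sum_def)

lemma mixed_norm_two:
  assumes "\<And>x. x \<in> set xs \<Longrightarrow> q x = 2"
  shows "mixed_norm n q xs a j = sqrt (isum n xs (\<lambda>j. (a j)\<^sup>2) j)"
  using assms
proof (induction xs arbitrary: j)
  case Nil
  then show ?case by simp
next
  case (Cons x xs)
  have "isum n xs (\<lambda>j. (a j)\<^sup>2) j \<ge> 0" for j
    by (rule wsum_nonneg) simp_all
  then show ?case using Cons by (simp add: powr_half_sqrt sum_nonneg)
qed

lemma L2_set_sum_le: "L2_set (\<lambda>i. \<Sum>l\<in>S. f i l) I \<le> (\<Sum>l\<in>S. L2_set (\<lambda>i. f i l) I)"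
proof (induction S rule: infinite_finite_induct)
  case (insert l S)
  then show ?case
    using L2_set_triangle_ineq[of "\<lambda>i. f i l" "\<lambda>i. \<Sum>l\<in>S. f i l" I] by simp
qed (simp_all add: L2_set_def)

text \<open>The triangle inequality in \<open>\<ell>\<^sub>2\<close> moves an \<open>\<ell>\<^sub>1\<close> sum outwards across each \<open>\<ell>\<^sub>2\<close> position that
precedes it.\<close>

lemma mixed_norm_Minkowski:
  assumes "q k = 1" "\<And>x. x \<in> set xs \<Longrightarrow> q x = 2" "k \<notin> set xs"
  shows "mixed_norm n q (xs @ k # ys) a j \<le> (\<Sum>l<n. mixed_norm n q (xs @ ys) a (j(k := l)))"
  using assms
proof (induction xs arbitrary: j)
  case Nil
  then show ?case by (simp add: mixed_norm_nonneg sum_nonneg del: fun_upd_apply)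
next
  case (Cons x xs)
  have two: "mixed_norm n q (x # zs) a j = L2_set (\<lambda>i. mixed_norm n q zs a (j(x := i))) {..<n}" for zs j
    using Cons.prems by (simp add: L2_set_def mixed_norm_nonneg powr_half_sqrt sum_nonneg)
  have "mixed_norm n q ((x # xs) @ k # ys) a j
      \<le> L2_set (\<lambda>i. \<Sum>l<n. mixed_norm n q (xs @ ys) a (j(x := i, k := l))) {..<n}"
    unfolding append_Cons two
    using Cons by (intro L2_set_mono Cons.IH) (auto simp: mixed_norm_nonneg)
  also have "\<dots> \<le> (\<Sum>l<n. L2_set (\<lambda>i. mixed_norm n q (xs @ ys) a (j(x := i, k := l))) {..<n})"
    by (rule L2_set_sum_le)
  also have "\<dots> = (\<Sum>l<n. mixed_norm n q ((x # xs) @ ys) a (j(k := l)))"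
    unfolding append_Cons two using Cons.prems by (auto simp: fun_upd_twist)
  finally show ?case .
qed

lemma weighted_AM_GM:
  fixes u \<theta> :: "'a \<Rightarrow> real"
  assumes S: "finite S" "\<And>l. l \<in> S \<Longrightarrow> \<theta> l > 0" "sum \<theta> S = 1" and u: "\<And>l. l \<in> S \<Longrightarrow> u l \<ge> 0"
  shows "(\<Prod>l\<in>S. u l powr \<theta> l) \<le> (\<Sum>l\<in>S. \<theta> l * u l)"
proof (cases "\<exists>l\<in>S. u l = 0")
  case True
  then have "(\<Prod>l\<in>S. u l powr \<theta> l) = 0" using S by auto
  also have "0 \<le> (\<Sum>l\<in>S. \<theta> l * u l)"
    using S u by (intro sum_nonneg mult_nonneg_nonneg) (auto intro: less_imp_le)
  finally show ?thesis .
next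
  case False
  have "(\<Prod>l\<in>S. u l powr \<theta> l) = exp (\<Sum>l\<in>S. \<theta> l *\<^sub>R ln (u l))"
    using False S by (simp add: exp_sum powr_def)
  also have "\<dots> \<le> (\<Sum>l\<in>S. \<theta> l * exp (ln (u l)))"
    using S by (intro convex_on_sum[OF _ _ exp_convex]) (auto intro: less_imp_le)
  also have "\<dots> = (\<Sum>l\<in>S. \<theta> l * u l)"
    using False u by (intro sum.cong refl) (metis exp_ln order_le_less)
  finally show ?thesis .
qed

text \<open>Dividing each \<open>g l\<close> by its sum reduces the claim to the weighted inequality between arithmetic and
geometric means, applied for every \<open>i\<close>.\<close>

lemma Hoelder_prod:
  fixes g :: "'a \<Rightarrow> 'b \<Rightarrow> real"
  assumes S: "finite S" "\<And>l. l \<in> S \<Longrightarrow> \<theta> l > 0" "sum \<theta> S = 1"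
    and g: "\<And>l i. l \<in> S \<Longrightarrow> g l i \<ge> 0" and I: "finite I"
  shows "(\<Sum>i\<in>I. \<Prod>l\<in>S. g l i powr \<theta> l) \<le> (\<Prod>l\<in>S. (\<Sum>i\<in>I. g l i) powr \<theta> l)"
proof (cases "\<exists>l\<in>S. (\<Sum>i\<in>I. g l i) = 0")
  case True
  then obtain l where l: "l \<in> S" "(\<Sum>i\<in>I. g l i) = 0" by blast
  then have "g l i = 0" if "i \<in> I" for i
    using g I that by (simp add: sum_nonneg_eq_0_iff)
  then have "(\<Prod>l\<in>S. g l i powr \<theta> l) = 0" if "i \<in> I" for i
    using l S that by (intro prod_zero) auto
  then show ?thesis by (simp add: prod_nonneg)
next
  case False
  define G where "G l = (\<Sum>i\<in>I. g l i)" for l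
  have G: "G l > 0" if "l \<in> S" for l
    using False g that by (simp add: G_def order_less_le sum_nonneg)
  have "(\<Prod>l\<in>S. g l i powr \<theta> l) \<le> (\<Prod>l\<in>S. G l powr \<theta> l) * (\<Sum>l\<in>S. \<theta> l * (g l i / G l))" for i
  proof -
    have "(\<Prod>l\<in>S. g l i powr \<theta> l) = (\<Prod>l\<in>S. G l powr \<theta> l * (g l i / G l) powr \<theta> l)"
      using G g by (intro prod.cong refl) (force simp: powr_divide less_imp_le)
    also have "\<dots> \<le> (\<Prod>l\<in>S. G l powr \<theta> l) * (\<Sum>l\<in>S. \<theta> l * (g l i / G l))"
      unfolding prod.distrib using S G g
      by (intro mult_left_mono weighted_AM_GM prod_nonneg) (auto intro: divide_nonneg_pos)
    finally show ?thesis .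
  qed
  then have "(\<Sum>i\<in>I. \<Prod>l\<in>S. g l i powr \<theta> l)
      \<le> (\<Sum>i\<in>I. (\<Prod>l\<in>S. G l powr \<theta> l) * (\<Sum>l\<in>S. \<theta> l * (g l i / G l)))"
    by (rule sum_mono)
  also have "\<dots> = (\<Prod>l\<in>S. G l powr \<theta> l) * (\<Sum>l\<in>S. \<theta> l * ((\<Sum>i\<in>I. g l i) / G l))"
    unfolding sum_distrib_left[symmetric] sum.swap[of _ S I]
    by (simp add: sum_divide_distrib sum_distrib_left sum.swap[of _ S I])
  also have "(\<Sum>l\<in>S. \<theta> l * ((\<Sum>i\<in>I. g l i) / G l)) = (\<Sum>l\<in>S. \<theta> l)"
    using G by (intro sum.cong refl) (force simp: G_def)
  finally show ?thesis using S by (simp add: G_def)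
qed

text \<open>Induction from the innermost position outwards. At position \<open>x\<close> the inner norms are bounded by the
geometric mean with weights \<open>\<theta>\<close>, and the Hoelder inequality for the functions
\<open>(f l i) powr (p l x)\<close> is applied with weights \<open>\<omega> l = \<theta> l q x / p l x\<close>; the relation between \<open>q\<close>
and \<open>p\<close> says that these sum to \<open>1\<close>.\<close>

lemma mixed_norm_interpolation:
  assumes S: "finite S" "\<And>l. l \<in> S \<Longrightarrow> \<theta> l > 0" "sum \<theta> S = 1"
    and p: "\<And>l x. l \<in> S \<Longrightarrow> x \<in> set xs \<Longrightarrow> p l x > 0"
    and q: "\<And>x. x \<in> set xs \<Longrightarrow> q x > 0" "\<And>x. x \<in> set xs \<Longrightarrow> 1 / q x = (\<Sum>l\<in>S. \<theta> l / p l x)"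
  shows "mixed_norm n q xs a j \<le> (\<Prod>l\<in>S. mixed_norm n (p l) xs a j powr \<theta> l)"
  using p q
proof (induction xs arbitrary: j)
  case Nil
  show ?case
  proof (cases "a j = 0")
    case False
    then show ?thesis using S by (simp flip: powr_sum)
  qed (simp add: prod_nonneg)
next
  case (Cons x xs)
  define f where "f l i = mixed_norm n (p l) xs a (j(x := i))" for l i
  have f: "f l i \<ge> 0" for l i by (simp add: f_def mixed_norm_nonneg)
  define \<omega> where "\<omega> l = \<theta> l * q x / p l x" for l
  have \<omega>: "\<omega> l > 0" if "l \<in> S" for l
    using that S Cons.prems by (simp add: \<omega>_def)
  have "sum \<omega> S = (\<Sum>l\<in>S. \<theta> l / p l x) * q x"
    by (simp add: \<omega>_def sum_distrib_right)
  also have "\<dots> = 1 / q x * q x" using Cons.prems(3)[of x] by simp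
  also have "\<dots> = 1" using Cons.prems(2)[of x] by simp
  finally have \<omega>1: "sum \<omega> S = 1" .
  have "mixed_norm n q xs a (j(x := i)) powr q x \<le> (\<Prod>l\<in>S. (f l i powr p l x) powr \<omega> l)" for i
  proof -
    have "mixed_norm n q xs a (j(x := i)) powr q x \<le> (\<Prod>l\<in>S. f l i powr \<theta> l) powr q x"
      unfolding f_def using Cons by (intro powr_mono2) (auto simp: mixed_norm_nonneg less_imp_le)
    also have "\<dots> = (\<Prod>l\<in>S. (f l i powr \<theta> l) powr q x)"
      using f by (simp add: prod_powr_distrib)
    also have "\<dots> = (\<Prod>l\<in>S. (f l i powr p l x) powr \<omega> l)"
      using Cons.prems(1) by (intro prod.cong refl) (simp add: powr_powr \<omega>_def less_imp_neq[symmetric])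
    finally show ?thesis .
  qed
  then have "(\<Sum>i<n. mixed_norm n q xs a (j(x := i)) powr q x)
      \<le> (\<Sum>i<n. \<Prod>l\<in>S. (f l i powr p l x) powr \<omega> l)"
    by (rule sum_mono)
  also have "\<dots> \<le> (\<Prod>l\<in>S. (\<Sum>i<n. f l i powr p l x) powr \<omega> l)"
    using S \<omega> \<omega>1 by (intro Hoelder_prod) auto
  finally have "mixed_norm n q (x # xs) a j \<le> (\<Prod>l\<in>S. (\<Sum>i<n. f l i powr p l x) powr \<omega> l) powr (1 / q x)"
    using Cons.prems(2)[of x] unfolding mixed_norm.simps
    by (intro powr_mono2) (simp_all add: sum_nonneg)
  also have "\<dots> = (\<Prod>l\<in>S. ((\<Sum>i<n. f l i powr p l x) powr \<omega> l) powr (1 / q x))"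
    by (simp add: prod_powr_distrib)
  also have "\<dots> = (\<Prod>l\<in>S. mixed_norm n (p l) (x # xs) a j powr \<theta> l)"
    using Cons.prems(2)[of x]
    by (intro prod.cong refl) (simp add: powr_powr \<omega>_def f_def)
  finally show ?case .
qed

section \<open>Continuous multilinear forms\<close>

lemma multilinear_form_linear:
  assumes "multilinear_form m T" "z \<in> {1..m} \<rightarrow>\<^sub>E UNIV" "k \<in> {1..m}"
  shows "linear (\<lambda>x. T (z(k := x)))"
  using assms by (auto simp: multilinear_form_def)

lemma multilinear_form_scale:
  assumes "multilinear_form m T" "z \<in> {1..m} \<rightarrow>\<^sub>E UNIV" "A \<subseteq> {1..m}"
  shows "T (\<lambda>k\<in>{1..m}. if k \<in> A then c *\<^sub>R z k else z k) = c ^ card A * T z"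
proof -
  have "finite A" using assms(3) finite_subset by blast
  then show ?thesis
    using assms(3)
  proof (induction A)
    case empty
    then show ?case using assms(2) by (simp add: PiE_iff extensional_restrict)
  next
    case (insert x A)
    define y where "y = (\<lambda>k\<in>{1..m}. if k \<in> A then c *\<^sub>R z k else z k)"
    have y: "y \<in> {1..m} \<rightarrow>\<^sub>E UNIV" by (simp add: y_def)
    have x: "x \<in> {1..m}" "x \<notin> A" using insert by auto
    have "(\<lambda>k\<in>{1..m}. if k \<in> insert x A then c *\<^sub>R z k else z k) = y(x := c *\<^sub>R y x)"
      using x by (auto simp: y_def fun_eq_iff)
    moreover have "T (y(x := c *\<^sub>R y x)) = c * T (y(x := y x))"
      using linear_scale[OF multilinear_form_linear[OF assms(1) y x(1)], of c "y x"] by simp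
    moreover have "T y = c ^ card A * T z" unfolding y_def using insert by blast
    ultimately show ?case using insert.hyps by (simp del: fun_upd_apply)
  qed
qed

text \<open>Continuity at the origin gives a box \<open>V\<close> on which \<open>\<bar>T\<bar> < 1\<close>; scaling the unit ball by \<open>c\<close> moves it
into that box and scales \<open>T\<close> by \<open>c ^ m\<close>. Without this the supremum in \<open>form_norm\<close> would be
an unspecified value.\<close>

lemma continuous_multilinear_form_bounded:
  assumes T: "continuous_multilinear_form m T" and "m \<ge> 1"
  obtains B where "\<And>z. z \<in> {1..m} \<rightarrow>\<^sub>E {x. norm x \<le> 1} \<Longrightarrow> \<bar>T z\<bar> \<le> B"
proof -
  have ml: "multilinear_form m T"
    and cont: "continuous_map (product_topology (\<lambda>_. euclidean) {1..m}) euclideanreal T"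
    using T by (auto simp: continuous_multilinear_form_def)
  define zero where "zero = (\<lambda>k\<in>{1..m}. 0 :: 'a)"
  have zero: "zero \<in> {1..m} \<rightarrow>\<^sub>E UNIV" by (simp add: zero_def)
  have "T zero = 0"
  proof -
    have "linear (\<lambda>x. T (zero(1 := x)))"
      using multilinear_form_linear[OF ml zero] assms(2) by simp
    then have "T (zero(1 := 0)) = 0" by (rule linear_0)
    moreover have "zero(1 := 0) = zero" using assms(2) by (auto simp: zero_def)
    ultimately show ?thesis by simp
  qed
  define U where "U = {z \<in> {1..m} \<rightarrow>\<^sub>E UNIV. T z \<in> {-1<..<1}}"
  have opn: "openin (product_topology (\<lambda>_. euclidean) {1..m}) U"
    using openin_continuous_map_preimage[OF cont, of "{-1<..<1}"] by (simp add: U_def)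
  have zU: "zero \<in> U" using zero \<open>T zero = 0\<close> by (simp add: U_def)
  from bspec[OF iffD1[OF openin_product_topology_alt opn] zU]
  obtain V where V: "\<forall>k\<in>{1..m}. open (V k)" "zero \<in> PiE {1..m} V" "PiE {1..m} V \<subseteq> U"
    unfolding open_openin[symmetric] by (elim exE conjE)
  have "\<exists>d. \<forall>k\<in>{1..m}. d k > 0 \<and> ball 0 (d k) \<subseteq> V k"
  proof (rule bchoice, rule ballI)
    fix k assume k: "k \<in> {1..m}"
    then have "0 \<in> V k" using V(2) by (auto simp: zero_def PiE_iff)
    with bspec[OF V(1) k] show "\<exists>d>0. ball 0 d \<subseteq> V k" by (auto simp: open_contains_ball)
  qed
  then obtain d where d: "\<And>k. k \<in> {1..m} \<Longrightarrow> d k > 0 \<and> ball 0 (d k) \<subseteq> V k" by blast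
  define c where "c = Min (d ` {1..m}) / 2"
  have Min: "Min (d ` {1..m}) > 0" using d assms(2) by (subst Min_gr_iff) auto
  have c: "c > 0" "\<And>k. k \<in> {1..m} \<Longrightarrow> c < d k"
  proof -
    show "c > 0" using Min by (simp add: c_def)
    fix k assume "k \<in> {1..m}"
    then have "Min (d ` {1..m}) \<le> d k" by simp
    then show "c < d k" using Min unfolding c_def by linarith
  qed
  show ?thesis
  proof
    fix z :: "nat \<Rightarrow> 'a" assume z: "z \<in> {1..m} \<rightarrow>\<^sub>E {x. norm x \<le> 1}"
    then have z': "z \<in> {1..m} \<rightarrow>\<^sub>E UNIV" by (auto simp: PiE_iff)
    define y where "y = (\<lambda>k\<in>{1..m}. if k \<in> {1..m} then c *\<^sub>R z k else z k)"
    have "y k \<in> V k" if k: "k \<in> {1..m}" for k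
    proof -
      have "norm (z k) \<le> 1" using z k by (auto simp: PiE_iff)
      then have "norm (y k) < d k"
        using c(1) c(2)[OF k] k by (simp add: y_def le_less_trans[OF mult_left_le])
      then show ?thesis using d[OF k] by auto
    qed
    then have "y \<in> PiE {1..m} V" by (auto simp: y_def PiE_iff)
    then have "\<bar>T y\<bar> < 1" using V(3) by (auto simp: U_def)
    moreover have "T y = c ^ m * T z"
      unfolding y_def using multilinear_form_scale[OF ml z' subset_refl, of c] by simp
    ultimately show "\<bar>T z\<bar> \<le> 1 / c ^ m"
      using c(1) by (simp add: abs_mult field_simps)
  qed
qed

lemma abs_le_form_norm:
  assumes "continuous_multilinear_form m T" "m \<ge> 1" "z \<in> {1..m} \<rightarrow>\<^sub>E {x. norm x \<le> 1}"
  shows "\<bar>T z\<bar> \<le> form_norm m T"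
proof -
  obtain B where "\<And>z. z \<in> {1..m} \<rightarrow>\<^sub>E {x. norm x \<le> 1} \<Longrightarrow> \<bar>T z\<bar> \<le> B"
    using continuous_multilinear_form_bounded[OF assms(1,2)] by blast
  then have "bdd_above ((\<lambda>z. \<bar>T z\<bar>) ` ({1..m} \<rightarrow>\<^sub>E {x. norm x \<le> 1}))"
    by (auto simp: bdd_above_def)
  then show ?thesis
    unfolding form_norm_def using assms(3) by (intro cSUP_upper)
qed

lemma form_norm_nonneg:
  assumes "continuous_multilinear_form m T" "m \<ge> 1"
  shows "form_norm m T \<ge> 0"
  by (rule order_trans[OF abs_ge_zero abs_le_form_norm[OF assms, of "\<lambda>k\<in>{1..m}. 0"]]) simp

lemma form_norm_le:
  assumes "\<And>z. z \<in> {1..m} \<rightarrow>\<^sub>E {x. norm x \<le> 1} \<Longrightarrow> \<bar>T z\<bar> \<le> B"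
  shows "form_norm m T \<le> B"
  unfolding form_norm_def
proof (rule cSUP_least)
  have "(\<lambda>k\<in>{1..m}. 0) \<in> {1..m} \<rightarrow>\<^sub>E {x :: 'a. norm x \<le> 1}" by simp
  then show "{1..m} \<rightarrow>\<^sub>E {x :: 'a. norm x \<le> 1} \<noteq> {}" by blast
qed (rule assms)

section \<open>The inequality with mixed exponents\<close>

lemma e_c0_nth: "c0_nth (e_c0 j) i = (if i = j then 1 else 0)"
  by transfer simp

lemma linear_c0_nth: "linear (\<lambda>x. c0_nth x i)"
  by (rule linearI) simp_all

lemma norm_sum_e_c0_le:
  assumes "\<And>i. \<bar>s i\<bar> \<le> 1"
  shows "norm (\<Sum>i<n. s i *\<^sub>R e_c0 i) \<le> 1"
proof (rule norm_c0_leI)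
  fix l
  have "c0_nth (\<Sum>i<n. s i *\<^sub>R e_c0 i) l = (\<Sum>i<n. if l = i then s i else 0)"
    by (simp add: linear_sum[OF linear_c0_nth] e_c0_nth if_distrib cong: if_cong)
  then show "\<bar>c0_nth (\<Sum>i<n. s i *\<^sub>R e_c0 i) l\<bar> \<le> 1"
    using assms by simp
qed

text \<open>Expanding a form by linearity in the slots in \<open>xs\<close>: signed sums of the coefficients are values of \<open>T\<close>
at signed sums of unit vectors, which lie in the unit ball of \<open>c0\<close>.\<close>

lemma wsum_coefficients:
  fixes T :: "(nat \<Rightarrow> c0) \<Rightarrow> real"
  assumes T: "multilinear_form m T" and "distinct xs" "set xs \<subseteq> {1..m}"
  shows "wsum n w xs (\<lambda>j. T (\<lambda>k\<in>{1..m}. e_c0 (j k))) j =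
    T (\<lambda>k\<in>{1..m}. if k \<in> set xs then \<Sum>i<n. w k i *\<^sub>R e_c0 i else e_c0 (j k))"
  using assms(2,3)
proof (induction xs arbitrary: j)
  case Nil
  then show ?case by simp
next
  case (Cons x xs)
  define v where "v k = (\<Sum>i<n. w k i *\<^sub>R e_c0 i)" for k
  define z where "z = (\<lambda>k\<in>{1..m}. if k \<in> set xs then v k else e_c0 (j k))"
  have x: "x \<in> {1..m}" "x \<notin> set xs" using Cons.prems by auto
  have z: "z \<in> {1..m} \<rightarrow>\<^sub>E UNIV" by (simp add: z_def)
  note lin = multilinear_form_linear[OF T z x(1)]
  have upd: "(\<lambda>k\<in>{1..m}. if k \<in> set xs then v k else e_c0 ((j(x := i)) k)) = z(x := e_c0 i)" for i
    using x by (auto simp: z_def fun_eq_iff)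
  have "wsum n w (x # xs) (\<lambda>j. T (\<lambda>k\<in>{1..m}. e_c0 (j k))) j = (\<Sum>i<n. w x i * T (z(x := e_c0 i)))"
  proof -
    have "wsum n w xs (\<lambda>j. T (\<lambda>k\<in>{1..m}. e_c0 (j k))) (j(x := i)) = T (z(x := e_c0 i))" for i
      unfolding upd[symmetric] v_def using Cons.prems by (intro Cons.IH) auto
    then show ?thesis by simp
  qed
  also have "\<dots> = T (z(x := v x))"
    unfolding v_def by (simp add: linear_sum[OF lin] linear_scale[OF lin])
  also have "z(x := v x) = (\<lambda>k\<in>{1..m}. if k \<in> set (x # xs) then v k else e_c0 (j k))"
    using x by (auto simp: z_def fun_eq_iff)
  finally show ?case unfolding v_def .
qed

text \<open>The extreme case, with exponent \<open>1\<close> in one position and \<open>2\<close> in the others. The Minkowski inequality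
makes position \<open>k\<close> the outermost one, and after the Khinchin inequality has been applied to
the others it remains to bound \<open>\<Sum>l \<bar>\<dots>\<bar>\<close> for fixed signs in the other positions. Choosing
in position \<open>k\<close> the signs of these terms turns the sum into a single value of \<open>T\<close> on the unit ball.\<close>

lemma mixed_norm_one_two_le:
  fixes T :: "(nat \<Rightarrow> c0) \<Rightarrow> real"
  assumes T: "continuous_multilinear_form m T" and k: "k \<in> {1..m}"
  shows "mixed_norm n (\<lambda>i. if i = k then 1 else 2) [1..<Suc m] (\<lambda>j. T (\<lambda>k\<in>{1..m}. e_c0 (j k))) j
    \<le> 2 ^ (m - 1) * form_norm m T"
proof -
  define a where "a j = T (\<lambda>k\<in>{1..m}. e_c0 (j k))" for j
  define p where "p i = (if i = k then 1 else 2 :: real)" for i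
  have ml: "multilinear_form m T" using T by (simp add: continuous_multilinear_form_def)
  have "k \<in> set [1..<Suc m]" using k by auto
  then obtain xs ys where split: "[1..<Suc m] = xs @ k # ys"
    by (meson split_list)
  define zs where "zs = xs @ ys"
  have "distinct (xs @ k # ys)" unfolding split[symmetric] by simp
  then have zs: "distinct zs" "k \<notin> set zs" "k \<notin> set xs" by (auto simp: zs_def)
  have "set (xs @ k # ys) = {1..m}" unfolding split[symmetric] by auto
  then have set_zs: "insert k (set zs) = {1..m}" by (auto simp: zs_def)
  have "length (xs @ k # ys) = m" unfolding split[symmetric] by simp
  then have len: "length zs = m - 1" by (simp add: zs_def)
  have "mixed_norm n p [1..<Suc m] a j \<le> (\<Sum>l<n. mixed_norm n p zs a (j(k := l)))"
    unfolding split zs_def using zs(3) by (intro mixed_norm_Minkowski) (auto simp: p_def)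
  also have "\<dots> = (\<Sum>l<n. sqrt (isum n zs (\<lambda>j. (a (j(k := l)))\<^sup>2) j))"
    using zs by (intro sum.cong refl, subst mixed_norm_two) (auto simp: p_def wsum_upd)
  also have "\<dots> \<le> 2 ^ length zs * form_norm m T"
  proof (rule multiple_Khinchin[OF zs(1)])
    fix w :: "nat \<Rightarrow> nat \<Rightarrow> real" assume w: "\<And>x i. w x i \<in> {-1, 1}"
    define s where "s l = sgn (wsum n w zs a (j(k := l)))" for l
    define w' where "w' = w(k := s)"
    have w': "\<bar>w' x i\<bar> \<le> 1" for x i
      using w[of x i] by (auto simp: w'_def s_def abs_sgn_eq)
    have "(\<Sum>l<n. \<bar>wsum n w zs (\<lambda>j. a (j(k := l))) j\<bar>) = (\<Sum>l<n. s l * wsum n w zs a (j(k := l)))"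
      unfolding s_def wsum_upd[OF zs(2), symmetric] by (simp add: abs_sgn mult.commute)
    also have "\<dots> = wsum n w' (k # zs) a j"
      using zs by (auto simp: w'_def intro!: sum.cong wsum_weight_cong)
    also have "\<dots> = T (\<lambda>x\<in>{1..m}. if x \<in> set (k # zs) then \<Sum>i<n. w' x i *\<^sub>R e_c0 i else e_c0 (j x))"
      unfolding a_def using zs set_zs by (intro wsum_coefficients[OF ml]) auto
    also have "\<dots> \<le> form_norm m T"
      using k set_zs w'
      by (intro order_trans[OF abs_ge_self abs_le_form_norm[OF T]]) (auto intro!: norm_sum_e_c0_le)
    finally show "(\<Sum>l<n. \<bar>wsum n w zs (\<lambda>j. a (j(k := l))) j\<bar>) \<le> form_norm m T" .
  qed
  finally show ?thesis by (simp add: len a_def[abs_def] p_def[abs_def])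
qed

text \<open>The point \<open>(1 / q 1, \<dots>, 1 / q m)\<close> is a convex combination of the \<open>m\<close> extreme points that have one
coordinate \<open>1\<close> and the others \<open>1 / 2\<close>. The weight \<open>\<theta> l\<close> must satisfy
\<open>1 / q l = \<theta> l + (1 - \<theta> l) / 2\<close>, that is \<open>\<theta> l = 2 / q l - 1\<close>; it is nonnegative because \<open>q l \<le> 2\<close>,
and the weights sum to \<open>1\<close> by the condition on \<open>q\<close>. Interpolation runs over the set \<open>S\<close> of positive weights.\<close>

lemma BH_inequality_power:
  assumes m: "m \<ge> 1" and q: "\<forall>i\<in>{1..m}. q i \<in> {1..2}" "(\<Sum>i=1..m. 1 / q i) = (real m + 1) / 2"
  shows "BH_inequality m q (2 ^ (m - 1))"
  unfolding BH_inequality_def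
proof (intro allI impI)
  fix T :: "(nat \<Rightarrow> c0) \<Rightarrow> real" and n :: nat
  assume T: "continuous_multilinear_form m T" and "1 \<le> n"
  define a where "a = (\<lambda>j. T (\<lambda>k\<in>{1..m}. e_c0 (j k)))"
  define M where "M = 2 ^ (m - 1) * form_norm m T"
  have M: "M \<ge> 0" using form_norm_nonneg[OF T m] by (simp add: M_def)
  define \<theta> where "\<theta> l = 2 / q l - 1" for l
  define S where "S = {l \<in> {1..m}. \<theta> l \<noteq> 0}"
  define p where "p l i = (if i = l then 1 else 2 :: real)" for l i :: nat
  have q_pos: "q i > 0" if "i \<in> {1..m}" for i using q(1) that by force
  have \<theta>: "\<theta> l > 0" if "l \<in> S" for l
    using that q(1) q_pos[of l] by (auto simp: S_def \<theta>_def field_simps less_le)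
  have sum_S: "sum \<theta> S = 1"
  proof -
    have "sum \<theta> S = sum \<theta> {1..m}"
      by (rule sum.mono_neutral_left) (auto simp: S_def)
    also have "\<dots> = 2 * (\<Sum>i=1..m. 1 / q i) - real m"
      by (simp add: \<theta>_def sum_subtractf sum_distrib_left)
    finally show ?thesis using q(2) by simp
  qed
  have interp: "1 / q x = (\<Sum>l\<in>S. \<theta> l / p l x)" if "x \<in> {1..m}" for x
  proof -
    have "(\<Sum>l\<in>S. \<theta> l / p l x) = (\<Sum>l\<in>S. \<theta> l / 2 + (if l = x then \<theta> l / 2 else 0))"
      by (intro sum.cong) (auto simp: p_def)
    also have "\<dots> = sum \<theta> S / 2 + (if x \<in> S then \<theta> x / 2 else 0)"
      by (simp add: sum.distrib sum_divide_distrib S_def)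
    also have "(if x \<in> S then \<theta> x / 2 else 0) = \<theta> x / 2" using that by (auto simp: S_def)
    finally show ?thesis using sum_S by (simp add: \<theta>_def field_simps)
  qed
  have "mixed_sum m q n a = mixed_norm n q [1..<Suc m] a (\<lambda>_. 0)"
    by (rule mixed_sum_eq_mixed_norm[OF m])
  also have "\<dots> \<le> (\<Prod>l\<in>S. mixed_norm n (p l) [1..<Suc m] a (\<lambda>_. 0) powr \<theta> l)"
    using \<theta> sum_S q_pos interp by (intro mixed_norm_interpolation) (auto simp: S_def p_def)
  also have "\<dots> \<le> (\<Prod>l\<in>S. M powr \<theta> l)"
  proof (intro prod_mono conjI powr_mono2)
    fix l assume l: "l \<in> S"
    then show "0 \<le> \<theta> l" using \<theta> by (simp add: less_imp_le)
    show "mixed_norm n (p l) [1..<Suc m] a (\<lambda>_. 0) \<le> M"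
      unfolding p_def[abs_def] a_def M_def using l by (intro mixed_norm_one_two_le[OF T]) (simp add: S_def)
  qed (simp_all add: mixed_norm_nonneg)
  also have "\<dots> = M"
  proof (cases "M = 0")
    case True
    have "S \<noteq> {}" using sum_S by auto
    with True show ?thesis by (simp add: card_gt_0_iff S_def[THEN arg_cong[where f = finite]])
  next
    case False
    then show ?thesis using M sum_S by (simp flip: powr_sum)
  qed
  finally show "mixed_sum m q n (\<lambda>j. T (\<lambda>k\<in>{1..m}. e_c0 (j k))) \<le> 2 ^ (m - 1) * form_norm m T"
    by (simp add: a_def M_def)
qed

section \<open>An extremal form\<close>

text \<open>The form \<open>tree_form (m - 1) 0\<close> witnesses the lower bound. It is built on a binary tree whose leaves are
indexed by position 1: \<open>tree_form k p\<close> uses the leaves below the node \<open>p\<close> of height \<open>k\<close>, that is the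
leaves \<open>l\<close> with \<open>l div 2 ^ k = p\<close>. It combines the forms \<open>u, v\<close> of the two children as
\<open>(s + t) u + (s - t) v\<close>, where \<open>s, t\<close> are two coordinates of the vector in position \<open>k + 1\<close> reserved
for this node; at each internal node this is the extremal bilinear pattern
\<open>s u + t u + s v - t v\<close>.\<close>

primrec tree_form :: "nat \<Rightarrow> nat \<Rightarrow> (nat \<Rightarrow> c0) \<Rightarrow> real" where
  "tree_form 0 p z = c0_nth (z 1) p"
| "tree_form (Suc k) p z =
     (c0_nth (z (k + 2)) (2 * p) + c0_nth (z (k + 2)) (2 * p + 1)) * tree_form k (2 * p) z +
     (c0_nth (z (k + 2)) (2 * p) - c0_nth (z (k + 2)) (2 * p + 1)) * tree_form k (2 * p + 1) z"

lemma tree_form_upd_other: "i > Suc k \<Longrightarrow> tree_form k p (z(i := x)) = tree_form k p z"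
  by (induction k arbitrary: p) simp_all

lemma tree_form_linear: "i \<in> {1..Suc k} \<Longrightarrow> linear (\<lambda>x. tree_form k p (z(i := x)))"
proof (induction k arbitrary: p)
  case 0
  then show ?case by (simp add: linear_c0_nth)
next
  case (Suc k)
  show ?case
  proof (cases "i = k + 2")
    case True
    have "tree_form k r (z(i := x)) = tree_form k r z" for r x
      using True by (simp add: tree_form_upd_other del: fun_upd_apply)
    then have "tree_form (Suc k) p (z(i := x)) =
        (c0_nth x (2 * p) + c0_nth x (2 * p + 1)) * tree_form k (2 * p) z +
        (c0_nth x (2 * p) - c0_nth x (2 * p + 1)) * tree_form k (2 * p + 1) z" for x
      by (simp only: tree_form.simps True[symmetric] fun_upd_same)
    then show ?thesis
      by (simp only: linear_iff) (simp add: algebra_simps)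
  next
    case False
    then have "i \<in> {1..Suc k}" using Suc.prems by auto
    from Suc.IH[OF this] have "linear (\<lambda>x. tree_form k p (z(i := x)))" for p .
    with False show ?thesis
      by (simp add: linear_iff algebra_simps fun_upd_other del: fun_upd_apply)
  qed
qed

lemma continuous_map_c0_coordinate:
  assumes "i \<in> I"
  shows "continuous_map (product_topology (\<lambda>_. euclidean) I) euclideanreal (\<lambda>z. c0_nth (z i) l)"
proof -
  have "bounded_linear (\<lambda>x. c0_nth x l)"
    by (rule bounded_linear_intro[where K = 1]) (simp_all add: abs_c0_nth_le_norm)
  then have "continuous_map euclidean euclideanreal (\<lambda>x. c0_nth x l)"
    by (simp add: linear_continuous_on)
  from continuous_map_compose[OF continuous_map_product_projection[OF assms] this]
  show ?thesis by (simp add: o_def)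
qed

lemma tree_form_continuous:
  assumes "k < m"
  shows "continuous_map (product_topology (\<lambda>_. euclidean) {1..m}) euclideanreal (tree_form k p)"
  using assms
proof (induction k arbitrary: p)
  case 0
  then show ?case by (auto intro!: continuous_map_c0_coordinate)
next
  case (Suc k)
  then show ?case
    unfolding tree_form.simps
    by (intro continuous_map_add continuous_map_diff continuous_map_real_mult continuous_map_c0_coordinate Suc.IH)
      auto
qed

text \<open>Each level costs a factor \<open>2\<close>, since \<open>\<bar>s + t\<bar> + \<bar>s - t\<bar> = 2 max \<bar>s\<bar> \<bar>t\<bar> \<le> 2\<close>.\<close>

lemma tree_form_bound:
  assumes "\<And>i. i \<in> {1..Suc k} \<Longrightarrow> norm (z i) \<le> 1"
  shows "\<bar>tree_form k p z\<bar> \<le> 2 ^ k"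
  using assms
proof (induction k arbitrary: p)
  case 0
  then show ?case using abs_c0_nth_le_norm[of "z 1" p] by (simp add: order_trans)
next
  case (Suc k)
  define s t where "s = c0_nth (z (k + 2)) (2 * p)" and "t = c0_nth (z (k + 2)) (2 * p + 1)"
  have st: "\<bar>s\<bar> \<le> 1" "\<bar>t\<bar> \<le> 1"
    unfolding s_def t_def using Suc.prems[of "k + 2"] by (auto intro: order_trans[OF abs_c0_nth_le_norm])
  have IH: "\<bar>tree_form k r z\<bar> \<le> 2 ^ k" for r using Suc by simp
  have "\<bar>tree_form (Suc k) p z\<bar> \<le> \<bar>s + t\<bar> * \<bar>tree_form k (2 * p) z\<bar> + \<bar>s - t\<bar> * \<bar>tree_form k (2 * p + 1) z\<bar>"
    unfolding tree_form.simps s_def[symmetric] t_def[symmetric] abs_mult[symmetric] by (rule abs_triangle_ineq)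
  also have "\<dots> \<le> \<bar>s + t\<bar> * 2 ^ k + \<bar>s - t\<bar> * 2 ^ k"
    by (intro add_mono mult_left_mono IH) simp_all
  also have "\<dots> = (\<bar>s + t\<bar> + \<bar>s - t\<bar>) * 2 ^ k" by (simp add: algebra_simps)
  also have "\<dots> \<le> 2 * 2 ^ k" using st by (intro mult_right_mono) auto
  finally show ?case by simp
qed

text \<open>All coefficients are \<open>0\<close> or \<open>\<plusminus>1\<close>. The leaf \<open>j 1\<close> determines the nodes above it, and the
coefficient is nonzero exactly if \<open>p\<close> is the one of height \<open>k\<close> among them and, for
\<open>2 \<le> i \<le> k + 1\<close>, the index \<open>j i\<close> is one of the two that are reserved for the one of height
\<open>i - 1\<close>.\<close>

lemma tree_form_unit_vectors:
  assumes "k < m"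
  shows "\<bar>tree_form k p (\<lambda>i\<in>{1..m}. e_c0 (j i))\<bar> =
    (if j 1 div 2 ^ k = p \<and> (\<forall>i\<in>{2..Suc k}. j i div 2 = j 1 div 2 ^ (i - 1)) then 1 else 0)"
  using assms
proof (induction k arbitrary: p)
  case 0
  then show ?case by (auto simp: e_c0_nth)
next
  case (Suc k)
  define z where "z = (\<lambda>i\<in>{1..m}. e_c0 (j i))"
  define g where "g \<longleftrightarrow> (\<forall>i\<in>{2..Suc k}. j i div 2 = j 1 div 2 ^ (i - 1))"
  have IH: "\<bar>tree_form k r z\<bar> = (if j 1 div 2 ^ k = r \<and> g then 1 else 0)" for r
    unfolding z_def g_def using Suc.prems by (intro Suc.IH) simp
  have "{2..Suc (Suc k)} = insert (k + 2) {2..Suc k}" by auto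
  then have g_Suc: "(\<forall>i\<in>{2..Suc (Suc k)}. j i div 2 = j 1 div 2 ^ (i - 1)) \<longleftrightarrow>
      g \<and> j (k + 2) div 2 = j 1 div 2 ^ Suc k"
    by (auto simp: g_def)
  have half: "j 1 div 2 ^ Suc k = (j 1 div 2 ^ k) div 2"
    by (metis div_mult2_eq power_Suc2)
  have zk: "c0_nth (z (Suc (Suc k))) l = (if l = j (k + 2) then 1 else 0)" for l
    using Suc.prems by (simp add: z_def e_c0_nth)
  \<comment> \<open>At most one child lies above \<open>j 1\<close>, so one of the two summands vanishes and no cancellation occurs.\<close>
  consider "j (k + 2) div 2 \<noteq> p" | "j (k + 2) = 2 * p" | "j (k + 2) = 2 * p + 1" by linarith
  then have "\<bar>tree_form (Suc k) p z\<bar> = (if (j 1 div 2 ^ k) div 2 = p \<and> g \<and> j (k + 2) div 2 = p then 1 else 0)"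
  proof cases
    case 1
    then have "2 * p \<noteq> j (k + 2)" "2 * p + 1 \<noteq> j (k + 2)" by auto
    then show ?thesis using 1 by (simp add: zk)
  next
    case 2
    then have "tree_form (Suc k) p z = tree_form k (2 * p) z + tree_form k (2 * p + 1) z"
      by (simp add: zk)
    moreover have "tree_form k (2 * p) z = 0 \<or> tree_form k (2 * p + 1) z = 0"
      using IH[of "2 * p"] IH[of "2 * p + 1"] by (auto split: if_splits)
    ultimately have "\<bar>tree_form (Suc k) p z\<bar> = \<bar>tree_form k (2 * p) z\<bar> + \<bar>tree_form k (2 * p + 1) z\<bar>" by auto
    then show ?thesis unfolding IH using 2 by (auto split: if_splits)
  next
    case 3
    then have "tree_form (Suc k) p z = tree_form k (2 * p) z - tree_form k (2 * p + 1) z"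
      by (simp add: zk)
    moreover have "tree_form k (2 * p) z = 0 \<or> tree_form k (2 * p + 1) z = 0"
      using IH[of "2 * p"] IH[of "2 * p + 1"] by (auto split: if_splits)
    ultimately have "\<bar>tree_form (Suc k) p z\<bar> = \<bar>tree_form k (2 * p) z\<bar> + \<bar>tree_form k (2 * p + 1) z\<bar>" by auto
    then show ?thesis unfolding IH using 3 by (auto split: if_splits)
  qed
  then show ?case unfolding g_Suc half z_def[symmetric] by auto
qed

text \<open>Induction on the number \<open>d\<close> of innermost positions that are summed. Once \<open>j 1\<close> is fixed, exactly two
indices in each later position \<open>k\<close> lead to nonzero coefficients, and they contribute equally, so the
position multiplies the norm by \<open>2 powr (1 / q k)\<close>. The range \<open>2 ^ m\<close> is large enough to contain all
indices that occur.\<close>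

lemma mixed_norm_tree:
  assumes a: "\<And>j. \<bar>a j\<bar> = (if j 1 < 2 ^ (m - 1) \<and> (\<forall>i\<in>{2..m}. j i div 2 = j 1 div 2 ^ (i - 1)) then 1 else 0)"
    and q: "\<And>i. i \<in> {1..m} \<Longrightarrow> q i > 0" and d: "d < m"
  shows "mixed_norm (2 ^ m) q [Suc m - d..<Suc m] a j =
    (if j 1 < 2 ^ (m - 1) \<and> (\<forall>i\<in>{2..m - d}. j i div 2 = j 1 div 2 ^ (i - 1))
     then 2 powr (\<Sum>i\<in>{Suc m - d..m}. 1 / q i) else 0)"
  using d
proof (induction d arbitrary: j)
  case 0
  then show ?case using a by simp
next
  case (Suc d)
  define k where "k = m - d"
  have k: "2 \<le> k" "k \<le> m" "Suc m - Suc d = k" "Suc m - d = Suc k" "m - Suc d = k - 1"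
    using Suc.prems by (auto simp: k_def)
  define N where "N = (2::real) powr (\<Sum>i\<in>{Suc k..m}. 1 / q i)"
  define good where "good \<longleftrightarrow> j 1 < 2 ^ (m - 1) \<and> (\<forall>i\<in>{2..k - 1}. j i div 2 = j 1 div 2 ^ (i - 1))"
  define c where "c = j 1 div 2 ^ (k - 1)"
  have qk: "q k > 0" using q k by simp
  have ins: "{2..k} = insert k {2..k - 1}" using k by auto
  have IH: "mixed_norm (2 ^ m) q [Suc k..<Suc m] a (j(k := i)) = (if good \<and> i div 2 = c then N else 0)" for i
  proof -
    have "mixed_norm (2 ^ m) q [Suc k..<Suc m] a (j(k := i)) =
      (if (j(k := i)) 1 < 2 ^ (m - 1) \<and> (\<forall>l\<in>{2..k}. (j(k := i)) l div 2 = (j(k := i)) 1 div 2 ^ (l - 1)) then N else 0)"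
      using Suc.IH[of "j(k := i)"] Suc.prems k by (simp add: N_def k_def[symmetric] del: upt_Suc fun_upd_apply)
    also have "\<dots> = (if good \<and> i div 2 = c then N else 0)"
    proof -
      have fst: "(j(k := i)) 1 = j 1" using k by simp
      have "(\<forall>l\<in>{2..k - 1}. (j(k := i)) l div 2 = j 1 div 2 ^ (l - 1)) \<longleftrightarrow>
          (\<forall>l\<in>{2..k - 1}. j l div 2 = j 1 div 2 ^ (l - 1))"
        by (rule ball_cong) auto
      then show ?thesis
        unfolding fst ins ball_simps fun_upd_same good_def c_def by (simp only: conj_ac)
    qed
    finally show ?thesis .
  qed
  have "[k..<Suc m] = k # [Suc k..<Suc m]"
    using k by (subst upt_conv_Cons) simp_all
  then have "mixed_norm (2 ^ m) q [k..<Suc m] a j =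
      (\<Sum>i<2 ^ m. (if good \<and> i div 2 = c then N else 0) powr q k) powr (1 / q k)"
    by (simp only: mixed_norm.simps IH)
  also have "\<dots> = (if good then 2 powr (1 / q k) * N else 0)"
  proof (cases good)
    case True
    have "c \<le> j 1 div 2"
    proof -
      have "(2::nat) ^ 1 \<le> 2 ^ (k - 1)" using k by (intro power_increasing) auto
      then show ?thesis unfolding c_def by (intro div_le_mono2) auto
    qed
    moreover have "j 1 < 2 ^ (m - 1)" using True by (simp add: good_def)
    moreover have "(2::nat) ^ m = 2 * 2 ^ (m - 1)" using k by (cases m) auto
    ultimately have "2 * c + 1 < 2 ^ m" by linarith
    then have eq: "{i \<in> {..<2 ^ m}. i div 2 = c} = {2 * c, 2 * c + 1}" by auto
    have "(\<Sum>i<2 ^ m. (if good \<and> i div 2 = c then N else 0) powr q k) =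
        (\<Sum>i\<in>{i \<in> {..<2 ^ m}. i div 2 = c}. N powr q k)"
      using True by (intro sum.mono_neutral_cong_right) auto
    also have "\<dots> = 2 * N powr q k" unfolding eq by simp
    finally show ?thesis using True qk by (simp add: powr_mult powr_powr N_def)
  qed simp
  also have "2 powr (1 / q k) * N = 2 powr (\<Sum>i\<in>{k..m}. 1 / q i)"
  proof -
    have "{k..m} = insert k {Suc k..m}" using k by auto
    then show ?thesis by (simp add: N_def powr_add)
  qed
  finally show ?case unfolding k good_def .
qed

text \<open>The outermost sum has \<open>2 ^ (m - 1)\<close> equal nonzero terms, one for each leaf.\<close>

lemma mixed_sum_tree_form:
  assumes m: "m \<ge> 1" and q: "\<And>i. i \<in> {1..m} \<Longrightarrow> q i > 0"
  shows "mixed_sum m q (2 ^ m) (\<lambda>j. tree_form (m - 1) 0 (\<lambda>k\<in>{1..m}. e_c0 (j k))) =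
    2 powr ((real m - 1) / q 1 + (\<Sum>i=2..m. 1 / q i))"
proof -
  define a where "a = (\<lambda>j. tree_form (m - 1) 0 (\<lambda>k\<in>{1..m}. e_c0 (j k)))"
  define N where "N = (2::real) powr (\<Sum>i=2..m. 1 / q i)"
  have a: "\<bar>a j\<bar> = (if j 1 < 2 ^ (m - 1) \<and> (\<forall>i\<in>{2..m}. j i div 2 = j 1 div 2 ^ (i - 1)) then 1 else 0)" for j
    unfolding a_def using m by (subst tree_form_unit_vectors) (auto simp: div_eq_0_iff)
  have N: "mixed_norm (2 ^ m) q [2..<Suc m] a (j(1 := i)) = (if i < 2 ^ (m - 1) then N else 0)" for i j
    using mixed_norm_tree[of a m q "m - 1" "j(1 := i)", OF a q] m
    by (simp add: N_def numeral_2_eq_2 del: upt_Suc)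
  have "mixed_sum m q (2 ^ m) a = mixed_norm (2 ^ m) q [1..<Suc m] a (\<lambda>_. 0)"
    by (rule mixed_sum_eq_mixed_norm[OF m])
  also have "[1..<Suc m] = 1 # [2..<Suc m]"
    using m by (subst upt_conv_Cons) (simp_all add: numeral_2_eq_2 del: upt_Suc)
  also have "mixed_norm (2 ^ m) q (1 # [2..<Suc m]) a (\<lambda>_. 0) =
      (\<Sum>i<(2::nat) ^ m. (if i < 2 ^ (m - 1) then N else 0) powr q 1) powr (1 / q 1)"
    by (simp only: mixed_norm.simps N)
  also have "(\<Sum>i<(2::nat) ^ m. (if i < 2 ^ (m - 1) then N else 0) powr q 1) = (\<Sum>i<(2::nat) ^ (m - 1). N powr q 1)"
  proof (intro sum.mono_neutral_cong_right ballI)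
    have "(2::nat) ^ (m - 1) \<le> 2 ^ m" by (intro power_increasing) auto
    then show "{..<2 ^ (m - 1)} \<subseteq> {..<(2::nat) ^ m}" by auto
  qed auto
  also have "\<dots> = 2 powr (real m - 1) * N powr q 1"
    using m by (simp add: powr_realpow[symmetric] of_nat_diff)
  also have "\<dots> powr (1 / q 1) = 2 powr ((real m - 1) / q 1) * N"
    using q[of 1] m by (simp add: powr_mult powr_powr N_def)
  finally show ?thesis unfolding a_def N_def powr_add .
qed

section \<open>The optimal constant\<close>

lemma continuous_multilinear_tree_form:
  assumes "m \<ge> 1"
  shows "continuous_multilinear_form m (tree_form (m - 1) p)"
  unfolding continuous_multilinear_form_def multilinear_form_def
proof (intro conjI ballI)
  show "continuous_map (product_topology (\<lambda>_. euclidean) {1..m}) euclideanreal (tree_form (m - 1) p)"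
    using assms by (intro tree_form_continuous) simp
  show "linear (\<lambda>x. tree_form (m - 1) p (z(k := x)))" if "k \<in> {1..m}" for z k
    using that by (intro tree_form_linear) auto
qed

lemma BH_inequality_lower_bound:
  assumes m: "m \<ge> 1" and q: "\<And>i. i \<in> {1..m} \<Longrightarrow> q i > 0" and C: "BH_inequality m q C"
  shows "2 powr ((real m - 1) / q 1 + (\<Sum>i=2..m. 1 / q i) - (real m - 1)) \<le> C"
proof -
  define R where "R = (2::real) powr ((real m - 1) / q 1 + (\<Sum>i=2..m. 1 / q i))"
  define F where "F = form_norm m (tree_form (m - 1) 0)"
  note cont = continuous_multilinear_tree_form[OF m, of 0]
  have "R \<le> C * F"
    using C cont unfolding BH_inequality_def F_def R_def
    by (subst mixed_sum_tree_form[OF m q, symmetric]) auto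
  moreover have "F \<ge> 0" unfolding F_def by (rule form_norm_nonneg[OF cont m])
  moreover have "F \<le> 2 ^ (m - 1)"
    unfolding F_def using m by (intro form_norm_le tree_form_bound) (auto simp: PiE_iff)
  moreover have "R > 0" by (simp add: R_def)
  moreover have "C > 0"
    using \<open>R \<le> C * F\<close> \<open>R > 0\<close> \<open>F \<ge> 0\<close> by (smt (verit) mult_nonpos_nonneg)
  ultimately have "R \<le> C * 2 ^ (m - 1)"
    by (smt (verit) mult_left_mono)
  also have "(2::real) ^ (m - 1) = 2 powr (real m - 1)"
    using m by (simp add: powr_realpow[symmetric] of_nat_diff)
  finally show ?thesis
    unfolding R_def powr_diff by (simp add: field_simps)
qed

text \<open>The constants for which the inequality holds form a closed set, because each instance of the
inequality is a non-strict bound that is linear in \<open>C\<close>. Being nonempty and bounded below, the set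
contains its infimum, so \<open>LEAST\<close> denotes that infimum.\<close>

lemma BH_const_least:
  assumes m: "m \<ge> 1" and C: "BH_inequality m q C" and low: "\<And>C. BH_inequality m q C \<Longrightarrow> b \<le> C"
  shows "BH_inequality m q (BH_const m q)" "BH_inequality m q C' \<Longrightarrow> BH_const m q \<le> C'"
proof -
  define X where "X = {C. BH_inequality m q C}"
  have X: "X \<noteq> {}" "bdd_below X" using C low by (auto simp: X_def bdd_below_def)
  have le: "Inf X \<le> C" if "BH_inequality m q C" for C
    using that X by (intro cInf_lower) (auto simp: X_def)
  have Inf: "BH_inequality m q (Inf X)"
    unfolding BH_inequality_def
  proof (intro allI impI)
    fix T :: "(nat \<Rightarrow> c0) \<Rightarrow> real" and n :: nat
    assume T: "continuous_multilinear_form m T" and n: "1 \<le> n"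
    let ?S = "mixed_sum m q n (\<lambda>j. T (\<lambda>k\<in>{1..m}. e_c0 (j k)))"
    have S: "?S \<le> D * form_norm m T" if "D \<in> X" for D
      using that T n by (auto simp: X_def BH_inequality_def)
    show "?S \<le> Inf X * form_norm m T"
    proof (cases "form_norm m T = 0")
      case True
      then show ?thesis using S[of C] C by (simp add: X_def)
    next
      case False
      with form_norm_nonneg[OF T m] have pos: "form_norm m T > 0" by simp
      have "?S / form_norm m T \<le> Inf X"
        using X S pos by (intro cInf_greatest) (auto simp: pos_divide_le_eq)
      with pos show ?thesis by (simp add: pos_divide_le_eq)
    qed
  qed
  have "BH_const m q = Inf X"
    unfolding BH_const_def by (rule Least_equality) (use Inf le in auto)
  then show "BH_inequality m q (BH_const m q)" "BH_inequality m q C' \<Longrightarrow> BH_const m q \<le> C'"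
    using Inf le by auto
qed

theorem theorem2p1:
  fixes m :: nat and q :: "nat \<Rightarrow> real"
  assumes "m \<ge> 2"
    and "\<forall>i\<in>{1..m}. q i \<in> {1..2}"
    and "(\<Sum>i=1..m. 1 / q i) = (real m + 1) / 2"
  shows "(\<exists>C. BH_inequality m q C) \<and>
    BH_inequality m q (BH_const m q) \<and>
    (\<forall>C. BH_inequality m q C \<longrightarrow> BH_const m q \<le> C) \<and>
    BH_const m q \<ge>
      2 powr (((real m - 1) * q_hat m q 1 + (\<Sum>i=2..m. q_hat m q i)
                 - (real m - 1) * (\<Prod>i=1..m. q i)) / (\<Prod>i=1..m. q i))"
proof -
  have m: "m \<ge> 1" using assms(1) by simp
  have q: "q i > 0" if "i \<in> {1..m}" for i using assms(2) that by force
  define P where "P = (\<Prod>i=1..m. q i)"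
  have P: "P > 0" unfolding P_def using q by (intro prod_pos) simp
  define L where "L = (real m - 1) / q 1 + (\<Sum>i=2..m. 1 / q i) - (real m - 1)"
  have "((real m - 1) * q_hat m q 1 + (\<Sum>i=2..m. q_hat m q i) - (real m - 1) * P) / P = L"
  proof -
    have "q_hat m q i / P = 1 / q i" for i using P by (simp add: q_hat_def P_def[symmetric] del: One_nat_def)
    moreover have "((real m - 1) * q_hat m q 1 + (\<Sum>i=2..m. q_hat m q i) - (real m - 1) * P) / P =
        (real m - 1) * (q_hat m q 1 / P) + (\<Sum>i=2..m. q_hat m q i / P) - (real m - 1)"
      using P by (simp add: add_divide_distrib diff_divide_distrib sum_divide_distrib)
    ultimately show ?thesis by (simp add: L_def)
  qed
  moreover have up: "BH_inequality m q (2 ^ (m - 1))"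
    using m assms by (intro BH_inequality_power) auto
  moreover have low: "2 powr L \<le> C" if "BH_inequality m q C" for C
    unfolding L_def using BH_inequality_lower_bound[OF m q that] by simp
  moreover note BH_const_least[OF m up low]
  ultimately show ?thesis unfolding P_def by auto
qed

end
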